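(* Let $G$ be a finite simple graph containing an induced odd cycle $C_{2n+1}=(x_1,\ldots,x_{2n+1})$, $n\ge 1$ ($G$ may contain other cycles), and let $l=|E(G)\setminus E(C_{2n+1})|$. Let $y_1,\ldots,y_m$ be the distinct vertices of $C_{2n+1}$ that are incident to at least one edge of $E(G)\setminus E(C_{2n+1})$; for $1\le i\le m$ let $l_i$ be the number of edges of $E(G)\setminus E(C_{2n+1})$ incident to $y_i$, and let $u_i=(n-1)+(l-l_i)$. For $n+1\le j\le 2n-1+l$ let $d''_j$ be the number of subsets of $E(G)$ of cardinality $j$ that contain a Type-II minimum edge cover for $C_{2n+1}$ in $G$ but do not contain any Type-I minimum edge cover for $C_{2n+1}$ in $G$. Then for $1\le k\le n-1+l$, $$d''_{n+k}=\sum_{i=1}^{m}\left[\binom{l_i}{1}\binom{u_i}{k-1}+\binom{l_i}{2}\binom{u_i}{k-2}+\cdots+\binom{l_i}{l_i}\binom{u_i}{k-l_i}\right],$$ where $\binom{a}{b}=0$ if $b>a$ or $b<0$.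
   Context: Let $H$ be an induced subgraph of a finite simple graph $G$. An edge cover for $H$ in $G$ is a set $L\subseteq E(G)$ such that every vertex of $H$ is incident to some edge of $L$. It is a Type-I edge cover if $L\subseteq E(H)$, and a Type-II edge cover if $L$ contains some edge of $E(G)\setminus E(H)$. A Type-I (resp. Type-II) minimum edge cover for $H$ in $G$ is a Type-I (resp. Type-II) edge cover for $H$ in $G$ of smallest possible cardinality among all Type-I (resp. Type-II) edge covers for $H$ in $G$. *)

theory Defs
  imports Main
begin

text \<open>An edge is the two-element set of its end points.\<close>

datatype 'a graph = Graph (verts: "'a set") (edges: "'a set set")

definition finite_simple_graph :: "'a graph \<Rightarrow> bool" where
  "finite_simple_graph G \<longleftrightarrow>
     finite (verts G) \<and> (\<forall>e\<in>edges G. e \<subseteq> verts G \<and> card e = 2)"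

definition induced_subgraph :: "'a graph \<Rightarrow> 'a graph \<Rightarrow> bool" where
  "induced_subgraph H G \<longleftrightarrow>
     verts H \<subseteq> verts G \<and> edges H = {e \<in> edges G. e \<subseteq> verts H}"

text \<open>The cycle \<open>(x 1, \<dots>, x r)\<close>; it is a genuine cycle only when
  \<open>r \<ge> 3\<close> and \<open>x\<close> is injective on \<open>{1..r}\<close>.\<close>

definition cycle_graph :: "nat \<Rightarrow> (nat \<Rightarrow> 'a) \<Rightarrow> 'a graph" where
  "cycle_graph r x =
     Graph (x ` {1..r}) (insert {x r, x 1} {{x i, x (i + 1)} | i. 1 \<le> i \<and> i < r})"

definition edge_cover :: "'a graph \<Rightarrow> 'a graph \<Rightarrow> 'a set set \<Rightarrow> bool" where
  "edge_cover G H L \<longleftrightarrow> L \<subseteq> edges G \<and> (\<forall>v\<in>verts H. \<exists>e\<in>L. v \<in> e)"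

definition type_I_edge_cover :: "'a graph \<Rightarrow> 'a graph \<Rightarrow> 'a set set \<Rightarrow> bool" where
  "type_I_edge_cover G H L \<longleftrightarrow> edge_cover G H L \<and> L \<subseteq> edges H"

definition type_II_edge_cover :: "'a graph \<Rightarrow> 'a graph \<Rightarrow> 'a set set \<Rightarrow> bool" where
  "type_II_edge_cover G H L \<longleftrightarrow> edge_cover G H L \<and> (\<exists>e\<in>L. e \<in> edges G - edges H)"

definition type_I_min_edge_cover :: "'a graph \<Rightarrow> 'a graph \<Rightarrow> 'a set set \<Rightarrow> bool" where
  "type_I_min_edge_cover G H L \<longleftrightarrow>
     type_I_edge_cover G H L \<and> (\<forall>L'. type_I_edge_cover G H L' \<longrightarrow> card L \<le> card L')"

definition type_II_min_edge_cover :: "'a graph \<Rightarrow> 'a graph \<Rightarrow> 'a set set \<Rightarrow> bool" where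
  "type_II_min_edge_cover G H L \<longleftrightarrow>
     type_II_edge_cover G H L \<and> (\<forall>L'. type_II_edge_cover G H L' \<longrightarrow> card L \<le> card L')"

text \<open>The number \<open>d''\<^sub>j\<close>.\<close>

definition d_II :: "'a graph \<Rightarrow> 'a graph \<Rightarrow> nat \<Rightarrow> nat" where
  "d_II G H j = card {S. S \<subseteq> edges G \<and> card S = j \<and>
     (\<exists>L. type_II_min_edge_cover G H L \<and> L \<subseteq> S) \<and>
     \<not> (\<exists>L. type_I_min_edge_cover G H L \<and> L \<subseteq> S)}"

text \<open>The lower index is an integer, so that differences such as \<open>k - t\<close> are not
  truncated and the coefficient vanishes for negative lower index.\<close>

definition binom :: "nat \<Rightarrow> int \<Rightarrow> nat" where
  "binom a b = (if b < 0 then 0 else a choose nat b)"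

end

theory Submission
  imports Defs
begin

text \<open>
  An edge outside the induced cycle meets the cycle in at most one vertex. Hence, as soon as some
  outside edge meets the cycle, counting covered vertices shows that the Type-II minimum edge
  covers are exactly the sets \<open>insert e M\<close>, where \<open>e\<close> is an outside edge at a cycle vertex \<open>v\<close> and
  \<open>M\<close> is the unique perfect matching of the path obtained by deleting \<open>v\<close> from the cycle. Adding to
  \<open>M\<close> a cycle edge at \<open>v\<close> gives a Type-I minimum edge cover, so the sets to be counted contain \<open>M\<close>,
  none of the two cycle edges at \<open>v\<close>, at least one outside edge at \<open>v\<close>, and arbitrarily many of the
  remaining \<open>n - 1 + (l - l\<^sub>v)\<close> edges. The vertex \<open>v\<close> is determined by such a set as the only cycle
  vertex missed by its cycle edges, so the contributions of different \<open>v\<close> are disjoint.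
\<close>

section \<open>Counting subsets\<close>

lemma card_Union_le_mult:
  assumes "finite A" and "\<And>a. a \<in> A \<Longrightarrow> card a \<le> c"
  shows "card (\<Union>A) \<le> c * card A"
proof -
  have "card (\<Union>A) \<le> (\<Sum>a\<in>A. card a)"
    by (rule card_Union_le_sum_card)
  also have "\<dots> \<le> (\<Sum>a\<in>A. c)"
    by (rule sum_mono) (rule assms)
  finally show ?thesis by (simp add: mult.commute)
qed

text \<open>Such a set is determined by its traces on \<open>P\<close> and \<open>Q\<close>, which
  can be chosen independently once their sizes are fixed. Sorting by the size \<open>t\<close> of
  the trace on \<open>P\<close> gives the sum, and \<open>t\<close> starts at 1 because that trace
  is nonempty.\<close>

lemma card_subsets_two_blocks:
  fixes M P Q :: "'b set"
  assumes fin: "finite M" "finite P" "finite Q"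
    and disj: "M \<inter> P = {}" "M \<inter> Q = {}" "P \<inter> Q = {}"
  shows "card {S. M \<subseteq> S \<and> S \<subseteq> M \<union> P \<union> Q \<and> S \<inter> P \<noteq> {} \<and> card S = card M + k} =
    (\<Sum>t = 1..card P. binom (card P) (int t) * binom (card Q) (int k - int t))"
proof -
  \<comment> \<open>The size of the second component is compared over the integers: for
    \<open>t > k\<close> the block is then empty, in agreement with \<open>binom\<close> at a
    negative lower index.\<close>
  define B where "B t = {A. A \<subseteq> P \<and> card A = t} \<times> {A. A \<subseteq> Q \<and> int (card A) = int k - int t}" for t
  define f where "f = (\<lambda>(A, A'). M \<union> A \<union> A')"
  let ?F = "{S. M \<subseteq> S \<and> S \<subseteq> M \<union> P \<union> Q \<and> S \<inter> P \<noteq> {} \<and> card S = card M + k}"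
  have cardf: "card (M \<union> A \<union> A') = card M + card A + card A'" if "A \<subseteq> P" "A' \<subseteq> Q" for A A'
  proof -
    have "finite A" "finite A'" using that fin finite_subset by auto
    moreover have "M \<inter> A = {}" "(M \<union> A) \<inter> A' = {}" using that disj by auto
    ultimately show ?thesis using fin by (simp add: card_Un_disjoint)
  qed
  have finB: "finite (B t)" for t
    unfolding B_def using fin by simp
  have bij: "bij_betw f (\<Union>t\<in>{1..card P}. B t) ?F"
  proof (rule bij_betw_byWitness[where f' = "\<lambda>S. (S \<inter> P, S \<inter> Q)"])
    show "\<forall>a\<in>\<Union>t\<in>{1..card P}. B t. (f a \<inter> P, f a \<inter> Q) = a"
      unfolding f_def B_def using disj by auto
    show "\<forall>S\<in>?F. f (S \<inter> P, S \<inter> Q) = S"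
      unfolding f_def by auto
    show "f ` (\<Union>t\<in>{1..card P}. B t) \<subseteq> ?F"
    proof
      fix S assume "S \<in> f ` (\<Union>t\<in>{1..card P}. B t)"
      then obtain t A A' where S: "S = M \<union> A \<union> A'" and t: "1 \<le> t"
        and A: "A \<subseteq> P" "card A = t" "A' \<subseteq> Q" "int (card A') = int k - int t"
        unfolding f_def B_def by auto
      from A t have "A \<noteq> {}" by auto
      with A have "S \<inter> P \<noteq> {}" unfolding S by blast
      moreover have "card S = card M + k"
        unfolding S using cardf[OF A(1,3)] A by linarith
      ultimately show "S \<in> ?F" unfolding S using A by auto
    qed
    show "(\<lambda>S. (S \<inter> P, S \<inter> Q)) ` ?F \<subseteq> (\<Union>t\<in>{1..card P}. B t)"
    proof
      fix p assume "p \<in> (\<lambda>S. (S \<inter> P, S \<inter> Q)) ` ?F"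
      then obtain S where p: "p = (S \<inter> P, S \<inter> Q)" and S: "M \<subseteq> S" "S \<subseteq> M \<union> P \<union> Q"
        "S \<inter> P \<noteq> {}" "card S = card M + k" by auto
      have "S = M \<union> (S \<inter> P) \<union> (S \<inter> Q)" using S by blast
      with cardf[of "S \<inter> P" "S \<inter> Q"] S(4) have "card (S \<inter> P) + card (S \<inter> Q) = k"
        by simp
      moreover have "1 \<le> card (S \<inter> P)"
        using S(3) fin(2) by (simp add: Suc_le_eq card_gt_0_iff)
      moreover have "card (S \<inter> P) \<le> card P"
        using fin(2) by (simp add: card_mono)
      ultimately show "p \<in> (\<Union>t\<in>{1..card P}. B t)"
        unfolding p B_def by auto
    qed
  qed
  have cardB: "card (B t) = binom (card P) (int t) * binom (card Q) (int k - int t)" for t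
  proof -
    have "{A. A \<subseteq> Q \<and> int (card A) = int k - int t} =
        (if int k - int t < 0 then {} else {A. A \<subseteq> Q \<and> card A = nat (int k - int t)})"
      by auto
    then have "card {A. A \<subseteq> Q \<and> int (card A) = int k - int t} = binom (card Q) (int k - int t)"
      using fin by (simp add: binom_def n_subsets)
    then show ?thesis
      unfolding B_def using fin by (simp add: card_cartesian_product n_subsets binom_def)
  qed
  have "card ?F = card (\<Union>t\<in>{1..card P}. B t)"
    using bij_betw_same_card[OF bij] by simp
  also have "\<dots> = (\<Sum>t = 1..card P. card (B t))"
    by (rule card_UN_disjoint) (use finB in \<open>auto simp: B_def\<close>)
  finally show ?thesis by (simp add: cardB)
qed

section \<open>Odd cycles\<close>

lemma cycle_graph_rotate1:
  assumes r: "2 \<le> r" and inj: "inj_on x {1..r}"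
  defines "x' \<equiv> \<lambda>i. if i < r then x (i + 1) else x 1"
  shows "cycle_graph r x' = cycle_graph r x" and "inj_on x' {1..r}"
proof -
  have "x' ` {1..r} = x ` {1..r}"
  proof
    show "x' ` {1..r} \<subseteq> x ` {1..r}" using r by (auto simp: x'_def)
    show "x ` {1..r} \<subseteq> x' ` {1..r}"
    proof
      fix v assume "v \<in> x ` {1..r}"
      then obtain i where i: "1 \<le> i" "i \<le> r" "v = x i" by auto
      show "v \<in> x' ` {1..r}"
      proof (cases "i = 1")
        case True
        then have "v = x' r" using i by (simp add: x'_def)
        then show ?thesis using r by auto
      next
        case False
        then have "v = x' (i - 1)" "i - 1 \<in> {1..r}" using i by (auto simp: x'_def)
        then show ?thesis by blast
      qed
    qed
  qed
  moreover have "insert {x' r, x' 1} {{x' i, x' (i + 1)} | i. 1 \<le> i \<and> i < r} =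
    insert {x r, x 1} {{x i, x (i + 1)} | i. 1 \<le> i \<and> i < r}" (is "?L = ?R")
  proof
    show "?L \<subseteq> ?R"
    proof
      fix e assume "e \<in> ?L"
      then consider "e = {x' r, x' 1}" | i where "1 \<le> i" "i < r" "e = {x' i, x' (i + 1)}"
        by auto
      then show "e \<in> ?R"
      proof cases
        \<comment> \<open>The closing edge of \<open>x'\<close> is the first edge of
          \<open>x\<close>. In the next case, the edge of \<open>x'\<close> starting at
          \<open>r - 1\<close> is the closing edge of \<open>x\<close>.\<close>
        case 1
        then have "e = {x 1, x (1 + 1)}" using r by (simp add: x'_def)
        then show ?thesis using r by fastforce
      next
        case 2
        show ?thesis
        proof (cases "i + 1 < r")
          case True
          then have "e = {x (i + 1), x ((i + 1) + 1)}" using 2 by (simp add: x'_def)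
          then show ?thesis using True by (metis (mono_tags, lifting) insertCI le_add2 mem_Collect_eq)
        next
          case False
          then have "i + 1 = r" using 2 by simp
          then have "e = {x r, x 1}" using 2 by (simp add: x'_def)
          then show ?thesis by simp
        qed
      qed
    qed
    show "?R \<subseteq> ?L"
    proof
      fix e assume "e \<in> ?R"
      then consider "e = {x r, x 1}" | i where "1 \<le> i" "i < r" "e = {x i, x (i + 1)}"
        by auto
      then show "e \<in> ?L"
      proof cases
        case 1
        then have "e = {x' (r - 1), x' ((r - 1) + 1)}" using r by (simp add: x'_def)
        moreover have "1 \<le> r - 1" "r - 1 < r" using r by auto
        ultimately show ?thesis by blast
      next
        case 2
        show ?thesis
        proof (cases "i = 1")
          case True
          then have "e = {x' r, x' 1}" using 2 by (simp add: x'_def)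
          then show ?thesis by simp
        next
          case False
          then have "e = {x' (i - 1), x' ((i - 1) + 1)}" "1 \<le> i - 1" "i - 1 < r"
            using 2 by (auto simp: x'_def)
          then show ?thesis by blast
        qed
      qed
    qed
  qed
  ultimately show "cycle_graph r x' = cycle_graph r x"
    unfolding cycle_graph_def by simp
  show "inj_on x' {1..r}"
    by (rule inj_onI) (use inj in \<open>auto simp: x'_def dest: inj_onD split: if_splits\<close>)
qed

text \<open>Iterating the one-step rotation brings any vertex to position 1, so statements about an
  arbitrary cycle vertex need a proof only for \<open>x 1\<close>.\<close>

lemma cycle_graph_rotate:
  assumes "2 \<le> r" and "inj_on x {1..r}" and "v \<in> verts (cycle_graph r x)"
  obtains x' where "inj_on x' {1..r}" "cycle_graph r x' = cycle_graph r x" "x' 1 = v"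
proof -
  have "\<exists>x'. inj_on x' {1..r} \<and> cycle_graph r x' = cycle_graph r x \<and> x' 1 = x (Suc a)"
    if "Suc a \<le> r" "inj_on x {1..r}" for a x
    using that
  proof (induction a arbitrary: x)
    case 0
    then show ?case by auto
  next
    case (Suc a)
    let ?x = "\<lambda>i. if i < r then x (i + 1) else x 1"
    have "\<exists>x'. inj_on x' {1..r} \<and> cycle_graph r x' = cycle_graph r ?x \<and> x' 1 = ?x (Suc a)"
      by (rule Suc.IH) (use Suc.prems cycle_graph_rotate1[OF assms(1)] in auto)
    then show ?case
      using cycle_graph_rotate1[OF assms(1) Suc.prems(2)] Suc.prems(1) by auto
  qed
  moreover obtain a where "Suc a \<le> r" "v = x (Suc a)"
    using assms(3) by (auto simp: cycle_graph_def) (metis Suc_le_D)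
  ultimately show ?thesis using assms(2) that by blast
qed

text \<open>Disjointness of the edges is left to counting: on an odd cycle with
  \<open>2n + 1\<close> vertices, \<open>n\<close> edges can cover \<open>2n\<close> vertices only
  if no two of them meet.\<close>

definition near_perfect_matching :: "'a graph \<Rightarrow> 'a \<Rightarrow> 'a set set \<Rightarrow> bool" where
  "near_perfect_matching C v M \<longleftrightarrow>
     M \<subseteq> edges C \<and> 2 * card M + 1 = card (verts C) \<and> \<Union>M = verts C - {v}"

section \<open>Edges and near-perfect matchings of an odd cycle\<close>

locale odd_cycle =
  fixes n :: nat and x :: "nat \<Rightarrow> 'a" and C :: "'a graph"
  assumes n_pos: "n \<ge> 1"
    and inj: "inj_on x {1..2 * n + 1}"
    and C_def: "C = cycle_graph (2 * n + 1) x"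
begin

text \<open>Treating the closing edge as edge number \<open>2n + 1\<close> makes the edge set an
  injective image of an interval.\<close>

definition cyc_edge :: "nat \<Rightarrow> 'a set" where
  "cyc_edge i = {x i, if i = 2 * n + 1 then x 1 else x (i + 1)}"

lemma verts_eq: "verts C = x ` {1..2 * n + 1}"
  by (simp add: C_def cycle_graph_def)

lemma edges_eq: "edges C = cyc_edge ` {1..2 * n + 1}"
proof -
  have "{1..2 * n + 1} = insert (2 * n + 1) {i. 1 \<le> i \<and> i < 2 * n + 1}"
    by auto
  then have "cyc_edge ` {1..2 * n + 1} =
      insert (cyc_edge (2 * n + 1)) {cyc_edge i | i. 1 \<le> i \<and> i < 2 * n + 1}"
    by (simp add: image_Collect)
  also have "{cyc_edge i | i. 1 \<le> i \<and> i < 2 * n + 1} =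
      {{x i, x (i + 1)} | i. 1 \<le> i \<and> i < 2 * n + 1}"
    by (intro Collect_cong ex_cong1) (auto simp: cyc_edge_def)
  finally show ?thesis
    by (simp add: C_def cycle_graph_def cyc_edge_def)
qed

lemma x_eq_iff: "i \<in> {1..2 * n + 1} \<Longrightarrow> j \<in> {1..2 * n + 1} \<Longrightarrow> x i = x j \<longleftrightarrow> i = j"
  using inj by (rule inj_on_eq_iff)

lemma inj_cyc_edge: "inj_on cyc_edge {1..2 * n + 1}"
  by (rule inj_onI) (use n_pos in \<open>auto simp: cyc_edge_def doubleton_eq_iff x_eq_iff split: if_splits\<close>)

lemma card_verts: "card (verts C) = 2 * n + 1"
  by (simp add: verts_eq card_image[OF inj] del: One_nat_def)

lemma card_edges: "card (edges C) = 2 * n + 1"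
  by (simp add: edges_eq card_image[OF inj_cyc_edge] del: One_nat_def)

lemma finite_verts: "finite (verts C)" and finite_edges: "finite (edges C)"
  by (simp_all add: verts_eq edges_eq)

lemma card_edge: "e \<in> edges C \<Longrightarrow> card e = 2"
  using n_pos by (auto simp: edges_eq cyc_edge_def x_eq_iff)

lemma edge_subset: "e \<in> edges C \<Longrightarrow> e \<subseteq> verts C"
  by (auto simp: edges_eq cyc_edge_def verts_eq)

lemma mem_cyc_edge:
  assumes "j \<in> {1..2 * n + 1}" "i \<in> {1..2 * n + 1}"
  shows "x j \<in> cyc_edge i \<longleftrightarrow> i = j \<or> i + 1 = j \<or> i = 2 * n + 1 \<and> j = 1"
  using assms n_pos by (auto simp: cyc_edge_def x_eq_iff)

lemma first_edges: "{e \<in> edges C. x 1 \<in> e} = {cyc_edge 1, cyc_edge (2 * n + 1)}"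
  using n_pos by (auto simp: edges_eq mem_cyc_edge)

lemma first_degree: "card {e \<in> edges C. x 1 \<in> e} = 2"
  unfolding first_edges using n_pos inj_on_eq_iff[OF inj_cyc_edge, of 1 "2 * n + 1"] by auto

text \<open>The edges \<open>{x 2, x 3}\<close>, \<open>{x 4, x 5}\<close>, ... form such a
  matching. It is the only one: the edges at \<open>x 1\<close> are forbidden, so \<open>x 2\<close>
  must be matched to \<open>x 3\<close>, hence \<open>x 4\<close> to \<open>x 5\<close>, and so on
  around the cycle.\<close>

lemma near_perfect_matching_first:
  "near_perfect_matching C (x 1) M \<longleftrightarrow> M = (\<lambda>i. cyc_edge (2 * i)) ` {1..n}" (is "_ \<longleftrightarrow> M = ?M")
proof -
  have inj2: "inj_on (\<lambda>i. cyc_edge (2 * i)) {1..n}"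
    by (rule inj_onI) (use inj_on_eq_iff[OF inj_cyc_edge] in auto)
  have cardM: "card ?M = n"
    by (simp add: card_image[OF inj2] del: One_nat_def)
  have sub: "?M \<subseteq> edges C"
    by (auto simp: edges_eq)
  have Un: "\<Union>?M = verts C - {x 1}"
  proof
    show "\<Union>?M \<subseteq> verts C - {x 1}"
      using sub edge_subset by (fastforce simp: mem_cyc_edge)
    show "verts C - {x 1} \<subseteq> \<Union>?M"
    proof
      fix v assume "v \<in> verts C - {x 1}"
      then obtain j where j: "j \<in> {1..2 * n + 1}" "v = x j" "j \<noteq> 1"
        unfolding verts_eq by blast
      \<comment> \<open>The ends of \<open>cyc_edge (2 * i)\<close> are \<open>x (2 * i)\<close> and
        \<open>x (2 * i + 1)\<close>, so halving the position of a vertex finds its matching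
        edge.\<close>
      then have "j div 2 \<in> {1..n}"
        by auto
      moreover have "v \<in> cyc_edge (2 * (j div 2))"
        using j \<open>j div 2 \<in> {1..n}\<close> unfolding j(2) by (subst mem_cyc_edge) auto
      ultimately show "v \<in> \<Union>?M" by blast
    qed
  qed
  have "M = ?M" if M: "M \<subseteq> edges C" "2 * card M + 1 = card (verts C)" "\<Union>M = verts C - {x 1}"
  proof -
    have finM: "finite M" using M(1) finite_edges finite_subset by blast
    have cM: "card M = n" using M(2) card_verts by simp
    have cU: "card (\<Union>M) = 2 * n"
      using M(3) card_verts finite_verts by (simp add: verts_eq)
    \<comment> \<open>Two edges with a common vertex cover at most 3 vertices and the remaining
      \<open>n - 2\<close> edges at most \<open>2 * (n - 2)\<close>, one short of the
      \<open>2 * n\<close> vertices covered by \<open>M\<close>.\<close>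
    have disj: "p \<inter> q = {}" if "p \<in> M" "q \<in> M" "p \<noteq> q" for p q
    proof (rule ccontr)
      assume pq: "p \<inter> q \<noteq> {}"
      have fin: "finite p" "finite q"
        using that M(1) card_edge by (auto intro!: card_ge_0_finite)
      have "card (p \<union> q) + card (p \<inter> q) = 4"
        using card_Un_Int[OF fin] that M(1) card_edge by (simp add: subset_iff)
      moreover have "card (p \<inter> q) > 0" using pq fin by (simp add: card_gt_0_iff)
      ultimately have *: "card (p \<union> q) \<le> 3" by linarith
      have "card (\<Union>(M - {p, q})) \<le> 2 * card (M - {p, q})"
        by (rule card_Union_le_mult) (use finM M(1) card_edge in auto)
      also have "card (M - {p, q}) = n - 2"
        using that finM cM by (simp add: card_Diff_subset)
      finally have "card (p \<union> q \<union> \<Union>(M - {p, q})) \<le> 3 + 2 * (n - 2)"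
        using * card_Un_le[of "p \<union> q" "\<Union>(M - {p, q})"] by linarith
      moreover have "p \<union> q \<union> \<Union>(M - {p, q}) = \<Union>M" using that by blast
      \<comment> \<open>This ensures that the subtraction \<open>n - 2\<close> above was not
        truncated.\<close>
      moreover have "n \<ge> 2"
        using card_mono[OF finM, of "{p, q}"] that cM by simp
      ultimately show False using cU by simp
    qed
    have "cyc_edge (2 * i) \<in> M" if "i \<in> {1..n}" for i
      using that
    proof (induction i)
      case (Suc i)
      \<comment> \<open>For \<open>i = 0\<close> this edge contains the forbidden vertex
        \<open>x 1\<close>; otherwise it shares \<open>x (2 * i + 1)\<close> with an edge already
        known to be in \<open>M\<close>. Only the other edge at \<open>x (2 * i + 2)\<close> remains
        to cover that vertex.\<close>
      have odd: "cyc_edge (2 * i + 1) \<notin> M"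
      proof
        assume a: "cyc_edge (2 * i + 1) \<in> M"
        show False
        proof (cases "i = 0")
          case True
          then show False using a M(3) by (auto simp: cyc_edge_def)
        next
          case False
          then have "cyc_edge (2 * i) \<in> M" using Suc by simp
          moreover have "cyc_edge (2 * i) \<noteq> cyc_edge (2 * i + 1)"
            using Suc.prems False inj_on_eq_iff[OF inj_cyc_edge, of "2 * i" "2 * i + 1"] by simp
          moreover have "x (2 * i + 1) \<in> cyc_edge (2 * i) \<inter> cyc_edge (2 * i + 1)"
            using Suc.prems by (simp add: cyc_edge_def)
          ultimately show False using disj a by blast
        qed
      qed
      have "x (2 * i + 2) \<in> verts C - {x 1}"
        using Suc.prems by (auto simp: verts_eq x_eq_iff)
      then obtain e where "e \<in> M" "x (2 * i + 2) \<in> e" using M(3) by blast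
      moreover then obtain j where "j \<in> {1..2 * n + 1}" "e = cyc_edge j"
        using M(1) by (auto simp: edges_eq)
      ultimately have "e = cyc_edge (2 * i + 1) \<or> e = cyc_edge (2 * i + 2)"
        using Suc.prems by (auto simp: mem_cyc_edge)
      then show ?case using \<open>e \<in> M\<close> odd by auto
    qed simp
    then have "?M \<subseteq> M" by auto
    then have "?M = M" using cM cardM by (intro card_subset_eq[OF finM]) simp_all
    then show ?thesis by (rule sym)
  qed
  then show ?thesis
    unfolding near_perfect_matching_def using cardM card_verts sub Un by auto
qed

text \<open>Facts that mention only \<open>C\<close> and not its labelling can be transferred from
  \<open>x' 1\<close> to an arbitrary vertex through this change of labelling.\<close>

lemma reindex:
  assumes "v \<in> verts C"
  obtains x' where "odd_cycle n x' C" "x' 1 = v"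
proof -
  obtain x' where "inj_on x' {1..2 * n + 1}" "cycle_graph (2 * n + 1) x' = C" "x' 1 = v"
    using cycle_graph_rotate[OF _ inj] assms n_pos unfolding C_def by auto
  then show ?thesis using that n_pos unfolding odd_cycle_def by metis
qed

lemma degree: "v \<in> verts C \<Longrightarrow> card {e \<in> edges C. v \<in> e} = 2"
  by (erule reindex) (use odd_cycle.first_degree in blast)

lemma ex1_near_perfect_matching: "v \<in> verts C \<Longrightarrow> \<exists>!M. near_perfect_matching C v M"
proof (erule reindex)
  fix x' assume "odd_cycle n x' C" "x' 1 = v"
  then show ?thesis
    using odd_cycle.near_perfect_matching_first[of n x' C] by auto
qed

text \<open>The description is independent of the labelling, so one function serves all vertices,
  whereas the explicit list of edges is available only for a labelling starting at
  \<open>v\<close>.\<close>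

definition matching :: "'a \<Rightarrow> 'a set set" where
  "matching v = (THE M. near_perfect_matching C v M)"

lemma near_perfect_matching_iff:
  "v \<in> verts C \<Longrightarrow> near_perfect_matching C v M \<longleftrightarrow> M = matching v"
  unfolding matching_def using ex1_near_perfect_matching[of v] by (metis the1_equality)

lemma matching:
  assumes "v \<in> verts C"
  shows "matching v \<subseteq> edges C" "card (matching v) = n" "\<Union>(matching v) = verts C - {v}"
  using near_perfect_matching_iff[OF assms] card_verts by (auto simp: near_perfect_matching_def)

text \<open>The matching avoids \<open>v\<close>, so its \<open>n\<close> edges and the two edges at
  \<open>v\<close> are disjoint, leaving \<open>(2n + 1) - n - 2\<close>. These edges give the
  summand \<open>n - 1\<close> of the upper index \<open>u i\<close>.\<close>

lemma card_free_edges: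
  assumes "v \<in> verts C"
  shows "card (edges C - matching v - {e \<in> edges C. v \<in> e}) = n - 1"
proof -
  have "{e \<in> edges C. v \<in> e} \<subseteq> edges C - matching v"
    using matching[OF assms] by auto
  moreover have "finite (matching v)"
    using matching(1)[OF assms] finite_edges finite_subset by blast
  ultimately show ?thesis
    using matching[OF assms] degree[OF assms] card_edges finite_edges
    by (simp add: card_Diff_subset)
qed

end

section \<open>Minimum edge covers of an induced odd cycle\<close>

locale induced_odd_cycle = odd_cycle +
  fixes G :: "'a graph"
  assumes simple: "finite_simple_graph G"
    and induced: "induced_subgraph C G"
begin

definition outer :: "'a set set" where
  "outer = edges G - edges C"

lemma edges_C_subset: "edges C \<subseteq> edges G"
  using induced by (auto simp: induced_subgraph_def)

lemma finite_edges_G: "finite (edges G)"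
proof -
  have "edges G \<subseteq> Pow (verts G)" "finite (verts G)"
    using simple by (auto simp: finite_simple_graph_def)
  then show ?thesis by (simp add: finite_subset)
qed

lemma finite_outer: "finite outer"
  by (simp add: outer_def finite_edges_G)

text \<open>Inducedness enters here: an edge of \<open>G\<close> with both ends on the cycle belongs
  to \<open>C\<close>.\<close>

lemma outer_meets_once:
  assumes "e \<in> outer"
  shows "card (e \<inter> verts C) \<le> 1"
proof -
  have e: "card e = 2" "\<not> e \<subseteq> verts C"
    using assms simple induced by (auto simp: outer_def finite_simple_graph_def induced_subgraph_def)
  then have "finite e" using card.infinite by fastforce
  then have "card (e \<inter> verts C) < card e"
    using e by (intro psubset_card_mono) auto
  then show ?thesis using e by simp
qed

text \<open>A cycle edge covers two cycle vertices, an outer edge at most one.\<close>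

lemma card_covered_le:
  assumes "L \<subseteq> edges G"
  shows "card (\<Union>L \<inter> verts C) \<le> 2 * card (L \<inter> edges C) + card (L \<inter> outer)"
proof -
  let ?A = "L \<inter> edges C" and ?B = "(\<lambda>e. e \<inter> verts C) ` (L \<inter> outer)"
  have fin: "finite L" using assms finite_edges_G finite_subset by blast
  have "\<Union>L \<inter> verts C \<subseteq> \<Union>?A \<union> \<Union>?B"
    using assms by (auto simp: outer_def)
  moreover have "\<Union>?A \<union> \<Union>?B \<subseteq> verts C"
    using edge_subset by blast
  then have "finite (\<Union>?A \<union> \<Union>?B)"
    using finite_verts by (rule finite_subset)
  ultimately have "card (\<Union>L \<inter> verts C) \<le> card (\<Union>?A) + card (\<Union>?B)"
    by (meson card_Un_le card_mono le_trans)
  moreover have "card (\<Union>?A) \<le> 2 * card ?A"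
    by (rule card_Union_le_mult) (use fin card_edge in auto)
  moreover have "card (\<Union>?B) \<le> 1 * card ?B"
    by (rule card_Union_le_mult) (use fin outer_meets_once in auto)
  moreover have "card ?B \<le> card (L \<inter> outer)"
    using fin by (simp add: card_image_le)
  ultimately show ?thesis by linarith
qed

lemma card_split:
  assumes "L \<subseteq> edges G"
  shows "card L = card (L \<inter> edges C) + card (L \<inter> outer)"
proof -
  have "finite L" using assms finite_edges_G finite_subset by blast
  moreover have "L = (L \<inter> edges C) \<union> (L \<inter> outer)" "(L \<inter> edges C) \<inter> (L \<inter> outer) = {}"
    using assms by (auto simp: outer_def)
  ultimately show ?thesis by (metis card_Un_disjoint finite_Int)
qed

section \<open>Sizes and shapes of small edge covers\<close>

lemma edge_cover_card:
  assumes "edge_cover G C L"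
  shows "2 * n + 1 \<le> 2 * card (L \<inter> edges C) + card (L \<inter> outer)"
proof -
  have "\<Union>L \<inter> verts C = verts C" "L \<subseteq> edges G"
    using assms by (auto simp: edge_cover_def)
  then show ?thesis using card_covered_le[of L] card_verts by simp
qed

lemma edge_cover_insert_matching:
  assumes "v \<in> verts C" "v \<in> e" "e \<in> edges G"
  shows "edge_cover G C (insert e (matching v))"
  unfolding edge_cover_def
proof (intro conjI ballI)
  show "insert e (matching v) \<subseteq> edges G"
    using assms(3) matching(1)[OF assms(1)] edges_C_subset by blast
  fix w assume "w \<in> verts C"
  then have "w = v \<or> w \<in> \<Union>(matching v)" using matching(3)[OF assms(1)] by blast
  then show "\<exists>f\<in>insert e (matching v). w \<in> f" using assms(2) by blast
qed

lemma card_insert_matching: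
  assumes "v \<in> verts C" "v \<in> e"
  shows "card (insert e (matching v)) = n + 1"
proof -
  have "e \<notin> matching v" using assms matching(3) by blast
  moreover have "finite (matching v)"
    using matching(1)[OF assms(1)] finite_edges finite_subset by blast
  ultimately show ?thesis using matching(2)[OF assms(1)] by simp
qed

lemma type_I_insert_matching:
  assumes "v \<in> verts C" "v \<in> e" "e \<in> edges C"
  shows "type_I_edge_cover G C (insert e (matching v))"
  using edge_cover_insert_matching[OF assms(1,2)] assms matching(1)[OF assms(1)] edges_C_subset
  by (auto simp: type_I_edge_cover_def)

lemma ex_type_I_edge_cover:
  obtains L where "type_I_edge_cover G C L" "card L = n + 1"
proof -
  have v: "x 1 \<in> verts C" "x 1 \<in> cyc_edge 1" "cyc_edge 1 \<in> edges C"
    by (auto simp: verts_eq cyc_edge_def edges_eq)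
  then show ?thesis
    using that type_I_insert_matching card_insert_matching by blast
qed

text \<open>Without outer edges the counting bound reads \<open>2 * n + 1\<close> \<le>
  \<open>2 * card L\<close>, so parity forces \<open>n + 1\<close> edges, and this size is
  attained.\<close>

lemma type_I_min_edge_cover_iff:
  "type_I_min_edge_cover G C L \<longleftrightarrow> type_I_edge_cover G C L \<and> card L = n + 1"
proof -
  have ge: "n + 1 \<le> card L" if "type_I_edge_cover G C L" for L
  proof -
    have "edge_cover G C L" "L \<inter> edges C = L" "L \<inter> outer = {}"
      using that by (auto simp: type_I_edge_cover_def outer_def)
    then show ?thesis using edge_cover_card[of L] by simp
  qed
  then show ?thesis
    unfolding type_I_min_edge_cover_def using ex_type_I_edge_cover by (metis le_antisym)
qed

text \<open>With \<open>a\<close> cycle edges and \<open>b\<close> \<ge> 1 outer edges, the counting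
  bound gives \<open>2 * (a + b)\<close> \<ge> \<open>2 * n + 1 + b\<close> \<ge>
  \<open>2 * n + 2\<close>.\<close>

lemma type_II_edge_cover_card:
  assumes "type_II_edge_cover G C L"
  shows "n + 1 \<le> card L"
proof -
  have c: "edge_cover G C L" "L \<subseteq> edges G" and o: "L \<inter> outer \<noteq> {}"
    using assms by (auto simp: type_II_edge_cover_def outer_def edge_cover_def)
  from o have "card (L \<inter> outer) \<ge> 1"
    using finite_outer by (simp add: Suc_le_eq card_gt_0_iff)
  then show ?thesis using edge_cover_card[OF c(1)] card_split[OF c(2)] by linarith
qed

lemma type_II_insert_matching:
  assumes "v \<in> verts C" "v \<in> e" "e \<in> outer"
  shows "type_II_min_edge_cover G C (insert e (matching v))"
proof -
  have "type_II_edge_cover G C (insert e (matching v))"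
    using edge_cover_insert_matching[OF assms(1,2)] assms(3)
    by (auto simp: type_II_edge_cover_def outer_def)
  then show ?thesis
    using type_II_edge_cover_card card_insert_matching[OF assms(1,2)]
    by (simp add: type_II_min_edge_cover_def)
qed

text \<open>At this size there is one outer edge \<open>e\<close> and \<open>n\<close> cycle edges.
  The latter miss some vertex \<open>v\<close>, which \<open>e\<close> must cover; since
  \<open>e\<close> meets the cycle nowhere else, they cover all the rest and hence form the matching
  of \<open>v\<close>. The size is assumed in place of minimality because a minimum cover is larger
  when no outer edge meets the cycle.\<close>

lemma type_II_small:
  assumes L: "type_II_edge_cover G C L" "card L = n + 1"
  obtains e v where "e \<in> L" "e \<in> outer" "v \<in> verts C" "v \<in> e" "matching v \<subseteq> L"
proof -
  have c: "edge_cover G C L" "L \<subseteq> edges G" and o: "L \<inter> outer \<noteq> {}"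
    using L by (auto simp: type_II_edge_cover_def outer_def edge_cover_def)
  let ?N = "L \<inter> edges C"
  from o have "card (L \<inter> outer) \<ge> 1"
    using finite_outer by (simp add: Suc_le_eq card_gt_0_iff)
  \<comment> \<open>Subtracting twice the equation \<open>a + b = n + 1\<close> from
    \<open>2 * n + 1\<close> \<le> \<open>2 * a + b\<close> leaves \<open>b\<close> \<le> 1 for the
    number \<open>b\<close> of outer edges.\<close>
  then have one: "card (L \<inter> outer) = 1" and cN: "card ?N = n"
    using edge_cover_card[OF c(1)] card_split[OF c(2)] L(2) by linarith+
  then obtain e where e: "L \<inter> outer = {e}" by (auto simp: card_1_singleton_iff)
  have split: "L = insert e ?N" using e c(2) by (auto simp: outer_def)
  have finN: "finite ?N" using finite_edges by simp
  have UN: "\<Union>?N \<subseteq> verts C" using edge_subset by blast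
  have cUN: "card (\<Union>?N) \<le> 2 * n"
    using card_Union_le_mult[of ?N 2] finN card_edge cN by simp
  then have "\<Union>?N \<noteq> verts C" using card_verts by auto
  then obtain v where v: "v \<in> verts C" "v \<notin> \<Union>?N" using UN by blast
  have cov: "w \<in> e \<or> w \<in> \<Union>?N" if "w \<in> verts C" for w
  proof -
    obtain f where "f \<in> L" "w \<in> f" using c(1) \<open>w \<in> verts C\<close> by (auto simp: edge_cover_def)
    then show ?thesis using split by blast
  qed
  have ve: "v \<in> e" using cov v by blast
  have eo: "e \<in> outer" "e \<in> L" using e by auto
  have "verts C - {v} \<subseteq> \<Union>?N"
  proof
    fix w assume w: "w \<in> verts C - {v}"
    have "w \<notin> e"
    proof
      assume "w \<in> e"
      then have "{v, w} \<subseteq> e \<inter> verts C" using w v ve by auto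
      then have "card {v, w} \<le> card (e \<inter> verts C)"
        using finite_verts by (intro card_mono) auto
      then show False using outer_meets_once[OF eo(1)] w by auto
    qed
    then show "w \<in> \<Union>?N" using cov w by blast
  qed
  then have "\<Union>?N = verts C - {v}" using UN v by blast
  then have "near_perfect_matching C v ?N"
    using cN card_verts by (simp add: near_perfect_matching_def)
  then have "?N = matching v" using near_perfect_matching_iff[OF v(1)] by simp
  then show ?thesis using that eo ve v(1) by blast
qed

text \<open>If no outside edge meets the cycle, Type-II minimum edge covers have more than \<open>n + 1\<close> edges,
  but then their cycle edges alone form a Type-I minimum edge cover.\<close>

lemma contains_only_type_II_iff:
  assumes S: "S \<subseteq> edges G"
  shows "(\<exists>L. type_II_min_edge_cover G C L \<and> L \<subseteq> S) \<and> \<not> (\<exists>L. type_I_min_edge_cover G C L \<and> L \<subseteq> S)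
    \<longleftrightarrow> (\<exists>v\<in>verts C. matching v \<subseteq> S \<and> S \<inter> {e \<in> edges C. v \<in> e} = {} \<and> S \<inter> {e \<in> outer. v \<in> e} \<noteq> {})"
    (is "?L \<longleftrightarrow> ?R")
proof
  assume ?R
  then obtain v e where v: "v \<in> verts C" "matching v \<subseteq> S" "S \<inter> {e \<in> edges C. v \<in> e} = {}"
    and e: "e \<in> S" "e \<in> outer" "v \<in> e" by auto
  have "type_II_min_edge_cover G C (insert e (matching v))"
    by (rule type_II_insert_matching) fact+
  moreover have "insert e (matching v) \<subseteq> S" using v e by simp
  moreover have "\<not> type_I_min_edge_cover G C L" if "L \<subseteq> S" for L
  proof
    assume "type_I_min_edge_cover G C L"
    then have "L \<subseteq> edges C" "\<exists>f\<in>L. v \<in> f"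
      using v(1) by (auto simp: type_I_min_edge_cover_def type_I_edge_cover_def edge_cover_def)
    then show False using v(3) that by blast
  qed
  ultimately show ?L by blast
next
  assume ?L
  then obtain L where L: "type_II_min_edge_cover G C L" "L \<subseteq> S"
    and no: "\<And>L. L \<subseteq> S \<Longrightarrow> \<not> type_I_min_edge_cover G C L" by blast
  then have L2: "type_II_edge_cover G C L" and Lc: "edge_cover G C L"
    by (auto simp: type_II_min_edge_cover_def type_II_edge_cover_def)
  have v0: "\<exists>v0\<in>verts C. \<exists>e0\<in>outer. v0 \<in> e0"
  proof (rule ccontr)
    assume none: "\<not> ?thesis"
    have "card (L \<inter> outer) \<ge> 1" using L2 finite_outer
      by (auto simp: type_II_edge_cover_def outer_def Suc_le_eq card_gt_0_iff)
    \<comment> \<open>Adding an outer edge of \<open>L\<close> to a smallest Type-I cover gives a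
      Type-II cover, which bounds the minimum cover \<open>L\<close> by
      \<open>n + 2\<close>.\<close>
    obtain K where K: "type_I_edge_cover G C K" "card K = n + 1"
      by (rule ex_type_I_edge_cover)
    obtain e where e: "e \<in> L" "e \<in> outer"
      using L2 by (auto simp: type_II_edge_cover_def outer_def)
    have "type_II_edge_cover G C (insert e K)"
      using K e by (auto simp: type_I_edge_cover_def type_II_edge_cover_def edge_cover_def outer_def)
    then have "card L \<le> card (insert e K)"
      using L(1) unfolding type_II_min_edge_cover_def by blast
    also have "\<dots> \<le> n + 2" using K(2) card_insert_le_m1[of "n + 2" K e] by simp
    finally have "card L \<le> n + 2" .
    have "edge_cover G C (L \<inter> edges C)"
      unfolding edge_cover_def
    proof (intro conjI ballI)
      show "L \<inter> edges C \<subseteq> edges G" using edges_C_subset by blast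
      fix v assume v: "v \<in> verts C"
      then obtain f where "f \<in> L" "v \<in> f" "f \<in> edges G" using Lc unfolding edge_cover_def by blast
      then show "\<exists>e\<in>L \<inter> edges C. v \<in> e" using none v by (auto simp: outer_def)
    qed
    then have I: "type_I_edge_cover G C (L \<inter> edges C)" by (simp add: type_I_edge_cover_def)
    have "(L \<inter> edges C) \<inter> outer = {}" by (auto simp: outer_def)
    \<comment> \<open>By parity there are at least \<open>n + 1\<close> cycle edges, and the outer
      edge in \<open>L\<close> leaves room for no more.\<close>
    then have "2 * n + 1 \<le> 2 * card (L \<inter> edges C)"
      using edge_cover_card[OF \<open>edge_cover G C (L \<inter> edges C)\<close>] by simp
    moreover have "card L = card (L \<inter> edges C) + card (L \<inter> outer)"
      using Lc by (intro card_split) (simp add: edge_cover_def)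
    ultimately have "card (L \<inter> edges C) = n + 1"
      using \<open>card L \<le> n + 2\<close> \<open>card (L \<inter> outer) \<ge> 1\<close> by linarith
    then show False using no[of "L \<inter> edges C"] I L(2) type_I_min_edge_cover_iff by blast
  qed
  then obtain v0 e0 where "v0 \<in> verts C" "v0 \<in> e0" "e0 \<in> outer" by blast
  then have "card L \<le> n + 1"
    using L(1) type_II_insert_matching card_insert_matching unfolding type_II_min_edge_cover_def
    by metis
  then have "card L = n + 1" using type_II_edge_cover_card[OF L2] by simp
  then obtain e v where e: "e \<in> L" "e \<in> outer" "v \<in> verts C" "v \<in> e" "matching v \<subseteq> L"
    using type_II_small[OF L2] by blast
  have "S \<inter> {f \<in> edges C. v \<in> f} = {}"
  proof (rule ccontr)
    assume "\<not> ?thesis"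
    then obtain f where f: "f \<in> S" "f \<in> edges C" "v \<in> f" by blast
    then have "type_I_edge_cover G C (insert f (matching v))"
      by (intro type_I_insert_matching e(3))
    then have "type_I_min_edge_cover G C (insert f (matching v))"
      using card_insert_matching[OF e(3) f(3)] type_I_min_edge_cover_iff by blast
    then show False using no[of "insert f (matching v)"] f e L(2) by blast
  qed
  then show ?R using e L(2) by blast
qed

section \<open>Sorting the counted sets by the vertex that their cycle edges miss\<close>

definition family :: "nat \<Rightarrow> 'a \<Rightarrow> 'a set set set" where
  "family j v = {S. S \<subseteq> edges G \<and> card S = j \<and> matching v \<subseteq> S \<and>
     S \<inter> {e \<in> edges C. v \<in> e} = {} \<and> S \<inter> {e \<in> outer. v \<in> e} \<noteq> {}}"

text \<open>The \<open>n\<close> matching edges are forced and the two cycle edges at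
  \<open>v\<close> are excluded, so \<open>k\<close> edges remain to be chosen, at least one of them
  from the \<open>d\<close> outer edges at \<open>v\<close>. The other block consists of the free
  cycle edges and the outer edges away from \<open>v\<close>.\<close>

lemma card_family:
  assumes v: "v \<in> verts C"
  defines "d \<equiv> card {e \<in> outer. v \<in> e}"
  shows "card (family (n + k) v) =
    (\<Sum>t = 1..d. binom d (int t) * binom ((n - 1) + (card outer - d)) (int k - int t))"
proof -
  let ?P = "{e \<in> outer. v \<in> e}"
  let ?R = "edges C - matching v - {e \<in> edges C. v \<in> e}"
  let ?Q = "?R \<union> (outer - ?P)"
  have fin: "finite (matching v)" "finite ?P" "finite ?Q"
    using finite_subset[OF matching(1)[OF v] finite_edges] finite_outer finite_edges by auto
  have "card ?Q = card ?R + card (outer - ?P)"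
    using finite_outer finite_edges by (intro card_Un_disjoint) (auto simp: outer_def)
  moreover have "card (outer - ?P) = card outer - d"
    unfolding d_def using finite_outer by (simp add: card_Diff_subset)
  ultimately have Q: "card ?Q = (n - 1) + (card outer - d)"
    using card_free_edges[OF v] by simp
  have "family (n + k) v =
      {S. matching v \<subseteq> S \<and> S \<subseteq> matching v \<union> ?P \<union> ?Q \<and> S \<inter> ?P \<noteq> {} \<and> card S = card (matching v) + k}"
    (is "_ = ?F")
  proof (rule set_eqI)
    fix S
    have "matching v \<union> ?P \<union> ?Q = edges G - {e \<in> edges C. v \<in> e}"
      using matching(1,3)[OF v] edges_C_subset unfolding outer_def by blast
    then have "S \<subseteq> matching v \<union> ?P \<union> ?Q \<longleftrightarrow> S \<subseteq> edges G \<and> S \<inter> {e \<in> edges C. v \<in> e} = {}"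
      by blast
    then show "S \<in> family (n + k) v \<longleftrightarrow> S \<in> ?F"
      unfolding family_def matching(2)[OF v] by blast
  qed
  moreover have "matching v \<inter> ?P = {}" "matching v \<inter> ?Q = {}" "?P \<inter> ?Q = {}"
    using matching(1)[OF v] by (auto simp: outer_def)
  ultimately show ?thesis
    using card_subsets_two_blocks[OF fin] Q unfolding d_def by simp
qed

text \<open>A set in the family of \<open>w\<close> contains \<open>matching w\<close>, and
  therefore a cycle edge at \<open>v\<close>.\<close>

lemma family_disjoint:
  assumes "v \<in> verts C" "w \<in> verts C" "v \<noteq> w"
  shows "family j v \<inter> family j w = {}"
proof (rule ccontr)
  assume "\<not> ?thesis"
  then obtain S where S: "matching w \<subseteq> S" "S \<inter> {e \<in> edges C. v \<in> e} = {}"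
    by (auto simp: family_def)
  have "v \<in> \<Union>(matching w)" using assms matching(3) by simp
  then show False using S matching(1)[OF assms(2)] by blast
qed

lemma d_II_eq:
  "d_II G C j = (\<Sum>v | v \<in> verts C \<and> (\<exists>e\<in>outer. v \<in> e). card (family j v))"
proof -
  let ?V = "{v. v \<in> verts C \<and> (\<exists>e\<in>outer. v \<in> e)}"
  have "{S. S \<subseteq> edges G \<and> card S = j \<and> (\<exists>L. type_II_min_edge_cover G C L \<and> L \<subseteq> S) \<and>
      \<not> (\<exists>L. type_I_min_edge_cover G C L \<and> L \<subseteq> S)} = (\<Union>v\<in>?V. family j v)" (is "?F = _")
  proof (rule set_eqI)
    fix S
    have "S \<in> ?F \<longleftrightarrow> S \<subseteq> edges G \<and> card S = j \<and> (\<exists>v\<in>verts C. matching v \<subseteq> S \<and>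
        S \<inter> {e \<in> edges C. v \<in> e} = {} \<and> S \<inter> {e \<in> outer. v \<in> e} \<noteq> {})"
      using contains_only_type_II_iff[of S] by (simp cong: conj_cong)
    \<comment> \<open>Vertices without an outer edge may be dropped from the union: their families
      are empty, since membership demands an outer edge at the vertex.\<close>
    also have "\<dots> \<longleftrightarrow> S \<in> (\<Union>v\<in>?V. family j v)"
      unfolding family_def by auto
    finally show "S \<in> ?F \<longleftrightarrow> S \<in> (\<Union>v\<in>?V. family j v)" .
  qed
  then have "d_II G C j = card (\<Union>v\<in>?V. family j v)"
    unfolding d_II_def by simp
  also have "\<dots> = (\<Sum>v\<in>?V. card (family j v))"
  proof (rule card_UN_disjoint)
    show "finite ?V" using finite_verts by simp
    have "family j v \<subseteq> Pow (edges G)" for v by (auto simp: family_def)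
    then show "\<forall>v\<in>?V. finite (family j v)" using finite_edges_G finite_subset by blast
    show "\<forall>v\<in>?V. \<forall>w\<in>?V. v \<noteq> w \<longrightarrow> family j v \<inter> family j w = {}"
      using family_disjoint by blast
  qed
  finally show ?thesis .
qed

end

theorem lemma3p9:
  fixes G C :: "'a graph" and x y :: "nat \<Rightarrow> 'a"
    and n m l k :: nat and li u :: "nat \<Rightarrow> nat"
  assumes "finite_simple_graph G"
    and "n \<ge> 1"
    and "inj_on x {1..2 * n + 1}"
    and "C = cycle_graph (2 * n + 1) x"
    and "induced_subgraph C G"
    and "l = card (edges G - edges C)"
    and "bij_betw y {1..m} {v \<in> verts C. \<exists>e \<in> edges G - edges C. v \<in> e}"
    and "\<And>i. i \<in> {1..m} \<Longrightarrow> li i = card {e \<in> edges G - edges C. y i \<in> e}"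
    and "\<And>i. i \<in> {1..m} \<Longrightarrow> u i = (n - 1) + (l - li i)"
    and "1 \<le> k" and "k \<le> n - 1 + l"
  shows "d_II G C (n + k) =
    (\<Sum>i = 1..m. \<Sum>t = 1..li i. binom (li i) (int t) * binom (u i) (int k - int t))"
proof -
  interpret induced_odd_cycle n x C G
    by unfold_locales (use assms in auto)
  note bij = assms(7)[folded outer_def]
  have "d_II G C (n + k) = (\<Sum>i = 1..m. card (family (n + k) (y i)))"
    unfolding d_II_eq by (rule sum.reindex_bij_betw[OF bij, symmetric])
  also have "\<dots> = (\<Sum>i = 1..m. \<Sum>t = 1..li i. binom (li i) (int t) * binom (u i) (int k - int t))"
  proof (rule sum.cong[OF refl])
    fix i assume i: "i \<in> {1..m}"
    then have "y i \<in> verts C" using bij_betw_apply[OF bij] by blast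
    then show "card (family (n + k) (y i)) =
        (\<Sum>t = 1..li i. binom (li i) (int t) * binom (u i) (int k - int t))"
      using card_family assms(8)[OF i] assms(9)[OF i] assms(6) by (simp add: outer_def)
  qed
  finally show ?thesis .
qed

end
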